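(* Let $\delta\in\{0,\frac12\}$ and let $(b_1,b_2)\in\mathbb{R}^2$ lie in the open region enclosed by the lines $b_1=\frac12+\delta$, $b_1=1+\delta$, $b_2=1+\delta$ and $b_1+b_2=\frac52+2\delta$, that is, $$\tfrac12+\delta<b_1<1+\delta,\qquad b_2>1+\delta,\qquad b_1+b_2<\tfrac52+2\delta,$$ or in the region obtained from it by the exchange $b_1\leftrightarrow b_2$. Then the function $z\mapsto{}_1F_2(1;b_1,b_2;z)$ belongs to the Laguerre–Pólya class $LP^+$.
   Context: ${}_1F_2(a;b,c;z)=\sum_{n\ge0}\frac{(a)_n}{(b)_n(c)_n}\frac{z^n}{n!}$ is the generalized hypergeometric function, with $(x)_n$ the Pochhammer symbol. The Laguerre–Pólya class $LP^+$ is the set of entire functions that can be obtained as a limit, uniformly on compact subsets of $\mathbb{C}$, of a sequence of polynomials all of whose roots lie in $(-\infty,0]$. *)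

theory Defs
  imports "HOL-Complex_Analysis.Complex_Analysis"
begin

definition hypergeo_1F2 :: "complex \<Rightarrow> complex \<Rightarrow> complex \<Rightarrow> complex \<Rightarrow> complex" where
  "hypergeo_1F2 a b c z =
     (\<Sum>n. pochhammer a n / (pochhammer b n * pochhammer c n) * (z ^ n / fact n))"

lemma hypergeo_1F2_eq_eval_fps:
  "hypergeo_1F2 a b c z = eval_fps (fps_hypergeo [a] [b, c] 1) z"
  by (simp add: hypergeo_1F2_def eval_fps_def mult_ac)

text \<open>
  The series converges for all arguments. If \<open>b\<close> or \<open>c\<close> is a nonpositive integer, the function
  is undefined mathematically; here division by zero then truncates the series.
\<close>
lemma summable_hypergeo_1F2:
  fixes a b c z :: complex
  shows "summable (\<lambda>n. pochhammer a n / (pochhammer b n * pochhammer c n) * (z ^ n / fact n))"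
proof -
  define f where "f = (\<lambda>n. pochhammer a n / (pochhammer b n * pochhammer c n) * (z ^ n / fact n))"
  define q where "q = (\<lambda>n. (a + of_nat n) * z / ((b + of_nat n) * (c + of_nat n) * of_nat (Suc n)))"
  have step: "f (Suc n) = q n * f n" for n
    by (simp only: f_def q_def pochhammer_Suc fact_Suc power_Suc times_divide_times_eq mult_ac)
  have lim0: "(\<lambda>n. x / of_nat n) \<longlonglongrightarrow> 0" for x :: complex
    by (rule lim_const_over_n)
  have lim1: "(\<lambda>n. x / of_nat n + 1) \<longlonglongrightarrow> 1" for x :: complex
    using tendsto_add[OF lim0[of x] tendsto_const[of 1]] by simp
  have "(\<lambda>n. (a / of_nat n + 1) * ((z / of_nat n) * (1 / of_nat n)) /
      ((b / of_nat n + 1) * (c / of_nat n + 1) * (1 / of_nat n + 1))) \<longlonglongrightarrow>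
      (1 * (0 * 0)) / (1 * 1 * 1)"
    by (rule tendsto_divide[OF tendsto_mult[OF lim1 tendsto_mult[OF lim0 lim0]]
          tendsto_mult[OF tendsto_mult[OF lim1 lim1] lim1]]) simp
  moreover have "eventually (\<lambda>n. (a / of_nat n + 1) * ((z / of_nat n) * (1 / of_nat n)) /
      ((b / of_nat n + 1) * (c / of_nat n + 1) * (1 / of_nat n + 1)) = q n) sequentially"
    using eventually_gt_at_top[of 0]
  proof eventually_elim
    case (elim n)
    define m :: complex where "m = of_nat n"
    have m: "m \<noteq> 0" using elim by (simp add: m_def)
    have e: "x / m + 1 = (x + m) / m" for x using m by (simp add: add_divide_distrib)
    have "u / m * (z / m * (1 / m)) / (v / m * (w / m) * (t / m)) = u * z / (v * w * t)"
      for u v w t :: complex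
      using m by (simp only: times_divide_eq_left times_divide_eq_right divide_divide_eq_left divide_divide_eq_right mult_1_right) (simp add: divide_simps)
    then show ?case unfolding q_def m_def[symmetric] e of_nat_Suc .
  qed
  ultimately have "q \<longlonglongrightarrow> 0"
    using Lim_transform_eventually by fastforce
  then have "eventually (\<lambda>n. norm (q n) < 1 / 2) sequentially"
    by (auto dest: tendstoD[where e = "1 / 2"])
  then obtain N where N: "norm (q n) < 1 / 2" if "n \<ge> N" for n
    by (auto simp: eventually_sequentially)
  have "summable f"
  proof (rule summable_ratio_test[of "1/2" N])
    show "norm (f (Suc n)) \<le> 1 / 2 * norm (f n)" if "n \<ge> N" for n
      unfolding step norm_mult using N[OF that] by (intro mult_right_mono) auto
  qed simp
  then show ?thesis unfolding f_def .
qed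

text \<open>
  Every complex number is a root of the zero polynomial, so the root condition excludes it from
  the approximating sequences; nonzero constant polynomials are admitted.
\<close>
definition Laguerre_Polya_plus :: "(complex \<Rightarrow> complex) set" where
  "Laguerre_Polya_plus = {f. f holomorphic_on UNIV \<and>
     (\<exists>P :: nat \<Rightarrow> complex poly.
        (\<forall>n z. poly (P n) z = 0 \<longrightarrow> z \<in> \<real>\<^sub>\<le>\<^sub>0) \<and>
        (\<forall>K. compact K \<longrightarrow> uniform_limit K (\<lambda>n. poly (P n)) f sequentially))}"

end

theory Submission
  imports Defs "HOL-Computational_Algebra.Fundamental_Theorem_Algebra"
begin

text \<open>
  Write \<open>s ^ 2 = 4 * z\<close>, so that \<open>z\<close> is nonpositive exactly when \<open>s\<close> is imaginary. For
  \<open>\<delta> = 0\<close>, the function is, up to a constant, \<open>\<integral> cosh (s * t) dM\<close> for a measure \<open>M\<close> on the unit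
  interval, and for \<open>\<delta> = 1/2\<close> it is a multiple of \<open>\<integral> sinh (s * t) / s dM\<close>. Comparing power series, both claims are
  about the moments of \<open>M\<close>, and after subtracting \<open>\<delta>\<close> from the parameters they lead to the same \<open>M\<close>: the
  law of the square root of a product of two independent Beta variables. In the given region the
  density of \<open>M\<close> is increasing (\<open>profile_mono\<close>).

  For an increasing density the result is Polya's theorem that the cosine and sine transforms have
  only real zeros, and the proof constructs the polynomials of the Laguerre--Polya class directly.
  Cut the interval into \<open>n + 1\<close> equal cells. Their masses \<open>a k\<close> increase with \<open>k\<close>, so by Enestroem and
  Kakeya the polynomial \<open>q\<close> with coefficients \<open>a k\<close> has all its roots in the closed unit disc, and
  therefore \<open>\<bar>q (1 / \<zeta>)\<bar> < \<bar>q \<zeta>\<bar>\<close> for \<open>\<bar>\<zeta>\<bar> > 1\<close> (\<open>norm_poly_inverse_less\<close>). Insert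
  \<open>\<zeta> = (1 + s / (2 * n)) / (1 - s / (2 * n))\<close>, which approximates \<open>exp (s / n)\<close>, and clear denominators.
  The resulting polynomials \<open>A n\<close> satisfy \<open>\<bar>A n (- s)\<bar> < \<bar>A n s\<bar>\<close> for \<open>Re s > 0\<close> and converge locally
  uniformly to \<open>\<integral> exp (s * t) dM\<close> (\<open>norm_binom_sum_less\<close>, \<open>uniform_limit_transform\<close>). Hence their even
  and odd parts do not vanish off the imaginary axis. As polynomials in \<open>z\<close> these parts have only
  nonpositive roots, and they converge to the two functions above.
\<close>

section \<open>Polynomials with increasing coefficients\<close>

text \<open>
  This is the Enestroem--Kakeya theorem. Multiplying by \<open>\<zeta> - 1\<close> turns the coefficients into their
  nonnegative increments, whose sum is only \<open>a n\<close>; outside the unit disc the leading term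
  \<open>a n * \<zeta> ^ Suc n\<close> then outweighs all the others.
\<close>
lemma coeffs_incseq_imp_roots_in_unit_disc:
  fixes a :: "nat \<Rightarrow> real" and \<zeta> :: complex
  assumes a0: "0 \<le> a 0" and mono: "\<And>k. k < n \<Longrightarrow> a k \<le> a (Suc k)" and an: "0 < a n"
    and \<zeta>: "norm \<zeta> > 1"
  shows "(\<Sum>k\<le>n. of_real (a k) * \<zeta> ^ k) \<noteq> 0"
proof
  assume z: "(\<Sum>k\<le>n. of_real (a k) * \<zeta> ^ k) = 0"
  define d where "d k = (case k of 0 \<Rightarrow> a 0 | Suc j \<Rightarrow> a k - a j)" for k
  have d_nonneg: "d k \<ge> 0" if "k \<le> n" for k
    using that a0 mono[of "k - 1"] by (cases k) (auto simp: d_def)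
  have sum_d: "(\<Sum>k\<le>m. d k) = a m" for m
    by (induction m) (auto simp: d_def)
  have abel: "(\<zeta> - 1) * (\<Sum>k\<le>m. of_real (a k) * \<zeta> ^ k) =
      of_real (a m) * \<zeta> ^ Suc m - (\<Sum>k\<le>m. of_real (d k) * \<zeta> ^ k)" for m
    by (induction m) (auto simp: d_def algebra_simps)
  have "norm (of_real (a n) * \<zeta> ^ Suc n) = norm (\<Sum>k\<le>n. of_real (d k) * \<zeta> ^ k)"
    using abel[of n] z by simp
  also have "\<dots> \<le> (\<Sum>k\<le>n. d k * norm \<zeta> ^ k)"
    by (rule sum_norm_le) (use d_nonneg in \<open>auto simp: norm_mult norm_power\<close>)
  also have "\<dots> \<le> (\<Sum>k\<le>n. d k * norm \<zeta> ^ n)"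
    using d_nonneg \<zeta> by (intro sum_mono mult_left_mono power_increasing) auto
  also have "\<dots> = a n * norm \<zeta> ^ n"
    by (simp add: sum_d flip: sum_distrib_right)
  finally have "a n * (norm \<zeta> ^ Suc n) \<le> a n * norm \<zeta> ^ n"
    using an by (simp add: norm_mult norm_power)
  hence "norm \<zeta> ^ Suc n \<le> norm \<zeta> ^ n"
    using an by (simp only: mult_le_cancel_left_pos)
  moreover have "norm \<zeta> ^ n < norm \<zeta> ^ Suc n"
    using \<zeta> by (intro power_strict_increasing) auto
  ultimately show False by simp
qed

text \<open>
  For a root \<open>x\<close> in the closed unit disc, the points \<open>\<zeta>\<close> and \<open>w = 1 / cnj \<zeta>\<close> are mirror images in the
  unit circle, and \<open>\<bar>\<zeta>\<bar> * \<bar>w - x\<bar> \<le> \<bar>\<zeta> - x\<bar>\<close>. The product over all roots gives the inequality between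
  \<open>poly p w\<close> and \<open>poly p \<zeta>\<close>; since \<open>p\<close> is real, \<open>poly p w\<close> and \<open>poly p (1 / \<zeta>)\<close> have the same modulus.
\<close>
lemma norm_poly_inverse_less:
  fixes p :: "complex poly" and \<zeta> :: complex
  assumes real: "\<And>i. coeff p i \<in> \<real>" and deg: "degree p > 0"
    and roots: "\<And>z. norm z > 1 \<Longrightarrow> poly p z \<noteq> 0" and \<zeta>: "norm \<zeta> > 1"
  shows "norm (poly p (inverse \<zeta>)) < norm (poly p \<zeta>)"
proof -
  have p0: "p \<noteq> 0" using deg by auto
  define A where "A = proots p"
  have polyA: "poly p w = lead_coeff p * (\<Prod>x\<in>#A. w - x)" for w
    by (subst complex_poly_decompose_multiset[symmetric])
       (simp add: A_def poly_prod_mset image_mset.compositionality o_def)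
  have size_A: "size A = degree p" by (simp add: A_def size_proots_complex)
  have in_disc: "norm x \<le> 1" if "x \<in># A" for x
    using roots[of x] that p0 by (force simp: A_def)
  define w where "w = cnj (inverse \<zeta>)"
  have conj_p: "poly p (cnj z) = cnj (poly p z)" for z
    using real by (simp add: poly_altdef Reals_cnj_iff)
  have factor: "norm \<zeta> * norm (w - x) \<le> norm (\<zeta> - x)" if "norm x \<le> 1" for x
  proof -
    have "\<zeta> \<noteq> 0" using \<zeta> by auto
    have "norm \<zeta> * norm (w - x) = norm (cnj \<zeta> * (w - x))" by (simp add: norm_mult)
    also have "cnj \<zeta> * (w - x) = 1 - cnj \<zeta> * x"
      using \<open>\<zeta> \<noteq> 0\<close> by (simp add: w_def algebra_simps)
    finally have 1: "norm \<zeta> * norm (w - x) = norm (1 - cnj \<zeta> * x)" .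
    have "norm (\<zeta> - x) ^ 2 - norm (1 - cnj \<zeta> * x) ^ 2 = (norm \<zeta> ^ 2 - 1) * (1 - norm x ^ 2)"
      by (simp add: cmod_power2) (simp add: power2_eq_square algebra_simps)
    moreover have "\<dots> \<ge> 0"
      using \<zeta> that by (intro mult_nonneg_nonneg) (auto simp: power_le_one)
    ultimately have "norm (1 - cnj \<zeta> * x) ^ 2 \<le> norm (\<zeta> - x) ^ 2" by linarith
    thus ?thesis unfolding 1 by (rule power2_le_imp_le) simp
  qed
  have prods: "norm \<zeta> ^ size B * norm (\<Prod>x\<in>#B. w - x) \<le> norm (\<Prod>x\<in>#B. \<zeta> - x)"
    if "\<And>x. x \<in># B \<Longrightarrow> norm x \<le> 1" for B
    using that
  proof (induction B)
    case (add x B)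
    have "norm \<zeta> ^ size (add_mset x B) * norm (\<Prod>x\<in>#add_mset x B. w - x)
        = (norm \<zeta> * norm (w - x)) * (norm \<zeta> ^ size B * norm (\<Prod>x\<in>#B. w - x))"
      by (simp add: norm_mult mult_ac)
    also have "\<dots> \<le> norm (\<zeta> - x) * norm (\<Prod>x\<in>#B. \<zeta> - x)"
      using add by (intro mult_mono factor) auto
    finally show ?case by (simp add: norm_mult)
  qed simp
  have "norm \<zeta> ^ degree p * norm (poly p w) \<le> norm (poly p \<zeta>)"
    using mult_left_mono[OF prods[of A], of "norm (lead_coeff p)"] in_disc size_A
    by (simp add: polyA norm_mult mult_ac)
  moreover have "norm (poly p w) = norm (poly p (inverse \<zeta>))"
    by (simp only: w_def conj_p complex_mod_cnj)
  ultimately have le: "norm \<zeta> ^ degree p * norm (poly p (inverse \<zeta>)) \<le> norm (poly p \<zeta>)"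
    by simp
  show ?thesis
  proof (cases "poly p (inverse \<zeta>) = 0")
    case True
    thus ?thesis using roots[OF \<zeta>] by simp
  next
    case False
    have "1 * norm (poly p (inverse \<zeta>)) < norm \<zeta> ^ degree p * norm (poly p (inverse \<zeta>))"
      using False \<zeta> deg by (intro mult_strict_right_mono one_less_power) auto
    with le show ?thesis by simp
  qed
qed

text \<open>
  With \<open>u = 1 + s / (2 * n)\<close> and \<open>v = 1 - s / (2 * n)\<close> the \<open>k\<close>-th summand is
  \<open>a k * u ^ (n + k) * v ^ (n - k)\<close>, a polynomial substitute for \<open>a k * exp (s * k / n)\<close>. The exponents
  are chosen such that the whole sum is \<open>(u * v) ^ n\<close> times the polynomial with coefficients \<open>a\<close> at
  \<open>u / v\<close>, and that \<open>s \<mapsto> - s\<close> merely replaces \<open>u / v\<close> by its inverse.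
\<close>
definition binom_sum :: "(nat \<Rightarrow> real) \<Rightarrow> nat \<Rightarrow> complex poly" where
  "binom_sum a n = (\<Sum>k\<le>n. smult (of_real (a k))
     ([:1, inverse (2 * of_nat n):] ^ (n + k) * [:1, - inverse (2 * of_nat n):] ^ (n - k)))"

lemma poly_binom_sum:
  "poly (binom_sum a n) s =
     (\<Sum>k\<le>n. of_real (a k) * ((1 + s / (2 * of_nat n)) ^ (n + k) * (1 - s / (2 * of_nat n)) ^ (n - k)))"
  by (simp add: binom_sum_def poly_sum field_simps)

text \<open>
  The Hermite--Biehler property: it keeps the even and the odd part of the polynomial from vanishing
  off the imaginary axis.
\<close>
lemma norm_binom_sum_less:
  fixes a :: "nat \<Rightarrow> real" and s :: complex
  assumes a0: "0 \<le> a 0" and mono: "\<And>k. k < n \<Longrightarrow> a k \<le> a (Suc k)" and an: "0 < a n"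
    and n: "n > 0" and s: "Re s > 0"
  shows "norm (poly (binom_sum a n) (- s)) < norm (poly (binom_sum a n) s)"
proof -
  define u where "u = 1 + s / (2 * of_nat n)"
  define v where "v = 1 - s / (2 * of_nat n)"
  have uv: "norm v < norm u"
  proof -
    have "norm u ^ 2 - norm v ^ 2 = 4 * Re (s / (2 * of_nat n))"
      by (simp add: u_def v_def cmod_power2) (simp add: power2_eq_square algebra_simps)
    also have "Re (s / (2 * of_nat n)) = Re s / (2 * n)"
      using Re_divide_of_nat[of s "2 * n"] by simp
    finally have "norm u ^ 2 - norm v ^ 2 > 0" using s n by simp
    hence "norm v ^ 2 < norm u ^ 2" by simp
    thus ?thesis by (rule power2_less_imp_less) simp
  qed
  have u0: "u \<noteq> 0" using uv by auto
  have P: "poly (binom_sum a n) s = (\<Sum>k\<le>n. of_real (a k) * (u ^ (n + k) * v ^ (n - k)))"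
    by (simp add: poly_binom_sum u_def v_def)
  have N: "poly (binom_sum a n) (-s) = (\<Sum>k\<le>n. of_real (a k) * (v ^ (n + k) * u ^ (n - k)))"
    by (simp add: poly_binom_sum u_def v_def)
  show ?thesis
  proof (cases "v = 0")
    \<comment> \<open>Here \<open>u / v\<close> is meaningless, but only the summand \<open>k = n\<close> survives.\<close>
    case True
    have "poly (binom_sum a n) (-s) = 0"
      unfolding N using True n by (intro sum.neutral) auto
    moreover have "poly (binom_sum a n) s = (\<Sum>k\<in>{n}. of_real (a k) * (u ^ (n + k) * v ^ (n - k)))"
      unfolding P using True by (intro sum.mono_neutral_right) auto
    ultimately show ?thesis using an u0 by simp
  next
    case False
    define p where "p = (\<Sum>k\<le>n. monom (complex_of_real (a k)) k)"
    have coeff_p: "coeff p k = (if k \<le> n then of_real (a k) else 0)" for k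
      by (simp add: p_def coeff_sum)
    have poly_p: "poly p z = (\<Sum>k\<le>n. of_real (a k) * z ^ k)" for z
      by (simp add: p_def poly_sum poly_monom)
    have "n \<le> degree p" using an by (intro le_degree) (auto simp: coeff_p)
    hence deg: "degree p > 0" using n by simp
    have z1: "norm (u / v) > 1" using uv False by (simp add: norm_divide)
    have less: "norm (poly p (inverse (u / v))) < norm (poly p (u / v))"
    proof (rule norm_poly_inverse_less)
      show "coeff p i \<in> \<real>" for i by (auto simp: coeff_p)
      show "poly p z \<noteq> 0" if "norm z > 1" for z
        unfolding poly_p using coeffs_incseq_imp_roots_in_unit_disc[OF a0 mono an that] by simp
    qed (use deg z1 in auto)
    have regroup: "x ^ (n + k) * y ^ (n - k) = (x * y) ^ n * (x / y) ^ k"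
      if "k \<le> n" "y \<noteq> 0" for x y :: complex and k
      using that by (simp add: power_add power_diff power_mult_distrib power_divide)
    moreover have "poly (binom_sum a n) s = (u * v) ^ n * poly p (u / v)"
      unfolding P poly_p sum_distrib_left using False
      by (intro sum.cong refl) (simp add: regroup)
    moreover have "poly (binom_sum a n) (-s) = (u * v) ^ n * poly p (inverse (u / v))"
      unfolding N poly_p sum_distrib_left using False u0
      by (intro sum.cong refl) (simp add: regroup mult.commute[of u v])
    ultimately show ?thesis
      using less False u0 by (simp add: norm_mult norm_power)
  qed
qed

lemma poly_even_odd_decomposition:
  fixes p :: "'a :: comm_ring_1 poly"
  obtains e d where "\<And>s. poly p s = poly e (s ^ 2) + s * poly d (s ^ 2)"
proof -
  have "\<exists>e d. \<forall>s. poly p s = poly e (s ^ 2) + s * poly d (s ^ 2)"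
  proof (induction p)
    case 0
    show ?case by (intro exI[of _ 0]) simp
  next
    case (pCons a p)
    then obtain e d where "\<And>s. poly p s = poly e (s ^ 2) + s * poly d (s ^ 2)" by blast
    hence "\<forall>s. poly (pCons a p) s = poly (pCons a d) (s ^ 2) + s * poly e (s ^ 2)"
      by (simp add: algebra_simps power2_eq_square)
    thus ?case by blast
  qed
  thus thesis using that by blast
qed

text \<open>
  The variable \<open>z\<close> of the target function and the variable \<open>s\<close> of the exponentials are related by
  \<open>s ^ 2 = 4 * z\<close>: the nonpositive reals correspond exactly to the imaginary axis.
\<close>
lemma sqrt_of_4z_right_half_plane:
  fixes z :: complex
  assumes "z \<notin> \<real>\<^sub>\<le>\<^sub>0"
  obtains s where "s ^ 2 = 4 * z" "Re s > 0"
proof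
  show "(2 * csqrt z) ^ 2 = 4 * z" by (simp add: power_mult_distrib)
  have "Re (csqrt z) \<noteq> 0"
  proof
    assume "Re (csqrt z) = 0"
    hence "csqrt z ^ 2 = - of_real (Im (csqrt z) ^ 2)"
      by (simp add: complex_eq_iff power2_eq_square)
    hence "z = of_real (- (Im (csqrt z) ^ 2))" by simp
    thus False using assms by (metis complex_nonpos_Reals_iff Re_complex_of_real Im_complex_of_real neg_le_0_iff_le zero_le_power2)
  qed
  moreover have "Re (csqrt z) \<ge> 0" using csqrt_principal[of z] by auto
  ultimately show "Re (2 * csqrt z) > 0" by simp
qed

section \<open>Approximating exponentials by binomial powers\<close>

lemma norm_exp_diff_le:
  fixes a b :: complex
  assumes "norm a \<le> r" "norm b \<le> r"
  shows "norm (exp a - exp b) \<le> exp r * norm (a - b)"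
proof (rule field_differentiable_bound[of "cball 0 r" exp exp])
  show "norm (exp z) \<le> exp r" if "z \<in> cball 0 r" for z :: complex
    using that norm_exp[of z] by (auto intro: order_trans)
qed (use assms in \<open>auto intro!: derivative_eq_intros\<close>)

lemma norm_exp_minus_linear_le:
  fixes y :: complex
  shows "norm (exp y - (1 + y)) \<le> exp (norm y) * norm y ^ 2"
proof -
  have "norm ((exp y - (1 + y)) - (exp 0 - (1 + 0))) \<le> (exp (norm y) * norm y) * norm (y - 0)"
  proof (rule field_differentiable_bound[of "cball 0 (norm y)" _ "\<lambda>z. exp z - 1"])
    show "norm (exp z - 1) \<le> exp (norm y) * norm y" if "z \<in> cball 0 (norm y)" for z :: complex
    proof -
      have "norm (exp z - exp 0) \<le> exp (norm y) * norm (z - 0)"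
        using that by (intro norm_exp_diff_le) auto
      also have "\<dots> \<le> exp (norm y) * norm y" using that by simp
      finally show ?thesis by simp
    qed
  qed (auto intro!: derivative_eq_intros)
  thus ?thesis by (simp add: power2_eq_square)
qed

lemma norm_power_mult_power_diff_le:
  fixes z w z' w' :: complex
  assumes c: "c > 0" and n: "norm z \<le> c" "norm w \<le> c" "norm z' \<le> c" "norm w' \<le> c"
  shows "norm (z ^ i * z' ^ j - w ^ i * w' ^ j) \<le>
           c ^ (i + j) * ((real i * norm (z - w) + real j * norm (z' - w')) / c)"
proof -
  \<comment> \<open>After scaling to the unit disc, differences of powers grow only linearly in the exponent.\<close>
  define Z where "Z = z / of_real c"
  define W where "W = w / of_real c"
  define Z' where "Z' = z' / of_real c"
  define W' where "W' = w' / of_real c"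
  have small: "norm Z \<le> 1" "norm W \<le> 1" "norm Z' \<le> 1" "norm W' \<le> 1"
    using c n by (auto simp: Z_def W_def Z'_def W'_def norm_divide)
  have d: "norm (Z - W) = norm (z - w) / c" "norm (Z' - W') = norm (z' - w') / c"
    using c by (auto simp: Z_def W_def Z'_def W'_def norm_divide simp flip: diff_divide_distrib)
  have "Z ^ i * Z' ^ j - W ^ i * W' ^ j = Z ^ i * (Z' ^ j - W' ^ j) + (Z ^ i - W ^ i) * W' ^ j"
    by (simp add: algebra_simps)
  also have "norm \<dots> \<le> norm (Z ^ i) * norm (Z' ^ j - W' ^ j) + norm (Z ^ i - W ^ i) * norm (W' ^ j)"
    by (metis norm_mult norm_triangle_ineq)
  also have "\<dots> \<le> 1 * (real j * norm (Z' - W')) + (real i * norm (Z - W)) * 1"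
    using small by (intro add_mono mult_mono norm_power_diff) (auto simp: norm_power power_le_one)
  finally have *: "norm (Z ^ i * Z' ^ j - W ^ i * W' ^ j) \<le>
      (real i * norm (z - w) + real j * norm (z' - w')) / c"
    by (simp add: d add_divide_distrib)
  have "z ^ i * z' ^ j - w ^ i * w' ^ j = of_real c ^ (i + j) * (Z ^ i * Z' ^ j - W ^ i * W' ^ j)"
    using c by (simp add: Z_def W_def Z'_def W'_def power_divide power_add field_simps)
  hence "norm (z ^ i * z' ^ j - w ^ i * w' ^ j) = c ^ (i + j) * norm (Z ^ i * Z' ^ j - W ^ i * W' ^ j)"
    using c by (simp add: norm_mult norm_power)
  also have "\<dots> \<le> c ^ (i + j) * ((real i * norm (z - w) + real j * norm (z' - w')) / c)"
    using c * by (intro mult_left_mono) auto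
  finally show ?thesis .
qed

text \<open>
  Each of the \<open>2 * n\<close> factors differs from the corresponding exponential by \<open>O(1 / n ^ 2)\<close>, so the product
  differs from \<open>exp (s * k / n)\<close> by \<open>O(1 / n)\<close>; moving \<open>k / n\<close> to \<open>t\<close> costs another \<open>O(1 / n)\<close>.
\<close>
lemma norm_binomial_minus_exp_le:
  fixes s :: complex
  assumes R: "norm s \<le> R" and n: "n > 0" and k: "k \<le> n"
    and t: "t \<in> {0..1}" "\<bar>t - k / n\<bar> \<le> 1 / n"
  shows "norm ((1 + s / (2 * of_nat n)) ^ (n + k) * (1 - s / (2 * of_nat n)) ^ (n - k)
            - exp (s * of_real t)) \<le> exp R * (R ^ 2 + R) / n"
proof -
  define y where "y = s / (2 * of_nat n)"
  \<comment> \<open>This bounds the norm of \<open>y\<close>, so that \<open>exp r\<close> bounds every factor and \<open>exp r ^ (2 * n) = exp R\<close>.\<close>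
  define r where "r = R / (2 * n)"
  have R0: "R \<ge> 0" using R norm_ge_zero[of s] by linarith
  have yr: "norm y \<le> r"
    using R n by (simp add: y_def r_def norm_divide norm_mult divide_right_mono)
  have r0: "r \<ge> 0" using yr norm_ge_zero[of y] by linarith
  have lin: "norm (1 + w - exp w) \<le> exp r * r ^ 2" if "norm w \<le> r" for w :: complex
  proof -
    have "norm (1 + w - exp w) \<le> exp (norm w) * norm w ^ 2"
      using norm_exp_minus_linear_le[of w] by (simp add: norm_minus_commute)
    also have "\<dots> \<le> exp r * r ^ 2"
      using that by (intro mult_mono power_mono) auto
    finally show ?thesis .
  qed
  have le_exp: "norm (1 + w) \<le> exp r" if "norm w \<le> r" for w :: complex
    using norm_triangle_ineq[of 1 w] that exp_ge_add_one_self[of r] norm_one[where 'a = complex]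
    by linarith
  have exp_le: "norm (exp w) \<le> exp r" if "norm w \<le> r" for w :: complex
    using norm_exp[of w] that by (auto intro: order_trans)
  have "norm ((1 + y) ^ (n + k) * (1 + (-y)) ^ (n - k) - exp y ^ (n + k) * exp (-y) ^ (n - k))
    \<le> exp r ^ ((n + k) + (n - k)) * ((real (n + k) * norm (1 + y - exp y)
          + real (n - k) * norm (1 + (-y) - exp (-y))) / exp r)"
    using yr by (intro norm_power_mult_power_diff_le le_exp exp_le) auto
  also have "\<dots> \<le> exp r ^ ((n + k) + (n - k)) * ((real (n + k) * (exp r * r ^ 2)
          + real (n - k) * (exp r * r ^ 2)) / exp r)"
    using yr by (intro mult_left_mono divide_right_mono add_mono lin) auto
  also have "\<dots> = exp r ^ (2 * n) * (2 * n * r ^ 2)"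
  proof -
    have "(real (n + k) * (exp r * r ^ 2) + real (n - k) * (exp r * r ^ 2)) / exp r
            = (real (n + k) + real (n - k)) * r ^ 2"
      by (simp add: field_simps)
    moreover have "n + k + (n - k) = 2 * n" "real (n + k) + real (n - k) = 2 * n"
      using k by auto
    ultimately show ?thesis by (simp only:)
  qed
  also have "exp r ^ (2 * n) = exp R"
    using n by (simp add: r_def flip: exp_of_nat_mult)
  also have "2 * n * r ^ 2 = R ^ 2 / (2 * n)"
    using n by (simp add: r_def field_simps power2_eq_square)
  also have "exp y ^ (n + k) * exp (-y) ^ (n - k) = exp (s * of_real (k / n))"
  proof -
    have "of_nat (n + k) * y + of_nat (n - k) * (-y) = s * of_real (k / n)"
      using n k by (simp add: y_def of_nat_diff field_simps)
    thus ?thesis by (simp flip: exp_of_nat_mult exp_add)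
  qed
  finally have 1: "norm ((1 + y) ^ (n + k) * (1 - y) ^ (n - k) - exp (s * of_real (k / n)))
       \<le> exp R * (R ^ 2 / (2 * n))" by simp
  have "norm (exp (s * of_real (k / n)) - exp (s * of_real t))
      \<le> exp R * norm (s * of_real (k / n) - s * of_real t)"
  proof (rule norm_exp_diff_le)
    have "norm s * x \<le> R" if "0 \<le> x" "x \<le> 1" for x
      using mult_mono[of "norm s" R x 1] R R0 that by simp
    from this[of "k / n"] this[of t]
    show "norm (s * of_real (k / n)) \<le> R" "norm (s * of_real t) \<le> R"
      using n k t by (auto simp: norm_mult norm_divide)
  qed
  also have "norm (s * of_real (k / n) - s * of_real t) = norm s * \<bar>t - k / n\<bar>"
    by (simp only: norm_of_real norm_mult flip: of_real_diff right_diff_distrib)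
       (simp add: abs_minus_commute)
  also have "exp R * (norm s * \<bar>t - k / n\<bar>) \<le> exp R * (R * (1 / n))"
    using R R0 t by (intro mult_left_mono mult_mono) auto
  finally have 2: "norm (exp (s * of_real (k / n)) - exp (s * of_real t)) \<le> exp R * (R / n)"
    by simp
  have "exp R * (R ^ 2 / (2 * n)) \<le> exp R * (R ^ 2 / n)"
    using n by (intro mult_left_mono divide_left_mono) auto
  with norm_diff_triangle_le[OF 1 2]
  have "norm ((1 + y) ^ (n + k) * (1 - y) ^ (n - k) - exp (s * of_real t))
      \<le> exp R * (R ^ 2 / n) + exp R * (R / n)" by linarith
  also have "\<dots> = exp R * (R ^ 2 + R) / n" by (simp add: add_divide_distrib distrib_left)
  finally show ?thesis by (simp only: y_def)
qed

text \<open>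
  Recovering the odd part means dividing by \<open>s\<close>, which spoils uniformity near \<open>0\<close>. By the maximum
  principle it is enough to control the quotient on a circle.
\<close>
lemma uniform_limit_cball_of_sphere:
  fixes f :: "nat \<Rightarrow> complex \<Rightarrow> complex"
  assumes f: "\<And>n. f n holomorphic_on cball 0 R" and g: "g holomorphic_on cball 0 R"
    and lim: "uniform_limit (sphere 0 R) f g sequentially" and R: "R > 0"
  shows "uniform_limit (cball 0 R) f g sequentially"
  unfolding uniform_limit_iff
proof (intro allI impI)
  fix \<epsilon> :: real assume "\<epsilon> > 0"
  hence "\<forall>\<^sub>F n in sequentially. \<forall>z\<in>sphere 0 R. dist (f n z) (g z) < \<epsilon> / 2"
    using lim unfolding uniform_limit_iff by (auto dest: spec[of _ "\<epsilon> / 2"])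
  thus "\<forall>\<^sub>F n in sequentially. \<forall>z\<in>cball 0 R. dist (f n z) (g z) < \<epsilon>"
  proof eventually_elim
    case (elim n)
    have holo: "(\<lambda>z. f n z - g z) holomorphic_on cball 0 R"
      by (intro holomorphic_on_diff f g)
    have "norm (f n z - g z) \<le> \<epsilon> / 2" if "z \<in> cball 0 R" for z
    proof (rule maximum_modulus_frontier[of "\<lambda>z. f n z - g z" "cball 0 R"])
      show "(\<lambda>z. f n z - g z) holomorphic_on interior (cball 0 R)"
        by (rule holomorphic_on_subset[OF holo]) (rule interior_subset)
      show "continuous_on (closure (cball 0 R)) (\<lambda>z. f n z - g z)"
        using holomorphic_on_imp_continuous_on[OF holo] by simp
      show "norm (f n w - g w) \<le> \<epsilon> / 2" if "w \<in> frontier (cball 0 R)" for w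
        using elim that R by (force simp: dist_norm)
    qed (use that in auto)
    thus ?case using \<open>\<epsilon> > 0\<close> by (force simp: dist_norm)
  qed
qed

section \<open>Even and odd parts of exponential integrals of increasing measures\<close>

text \<open>
  Monotonicity of a density matters only through the masses of the cells of an equidistant partition,
  which it makes an increasing sequence. The comparison of shifted intervals says just this, and it
  makes sense for densities that are unbounded near \<open>1\<close>, where pointwise values are of no use.
\<close>
locale increasing_measure = finite_measure M for M :: "real measure" +
  assumes sets_M [measurable_cong, simp]: "sets M = sets borel"
    and support: "AE t in M. t \<in> {0<..1}"
    and nontrivial: "measure M (space M) > 0"
    and increasing: "\<lbrakk>0 \<le> a; a \<le> b; b + l \<le> 1; 0 \<le> l\<rbrakk> \<Longrightarrow>
                       measure M {a<..a + l} \<le> measure M {b<..b + l}"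
begin

lemma space_M [simp]: "space M = UNIV"
  using sets_eq_imp_space_eq[OF sets_M] by simp

definition transform :: "complex \<Rightarrow> complex" where
  "transform s = (LINT t|M. exp (s * of_real t))"

text \<open>
  With \<open>n + 1\<close> cells, numbered from \<open>0\<close> to \<open>n\<close>, the fraction \<open>k / n\<close> lies in the closure of the
  \<open>k\<close>-th cell, so the \<open>k\<close>-th term of \<open>binom_sum\<close> approximates the exponential on the whole cell.
\<close>
definition cell :: "nat \<Rightarrow> nat \<Rightarrow> real set" where
  "cell n k = {real k / (n + 1)<..(real k + 1) / (n + 1)}"

lemma cell_sets [measurable, simp]: "cell n k \<in> sets borel"
  by (simp add: cell_def)

lemma integrable_cell:
  "integrable M (\<lambda>t. indicator (cell n k) t *\<^sub>R (c :: 'b :: {banach, second_countable_topology}))"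
  by (intro integrable_scaleR_left integrable_real_indicator) (auto simp: less_top[symmetric])

lemma in_cell_iff: "t \<in> cell n k \<longleftrightarrow> \<lceil>(real n + 1) * t\<rceil> = int k + 1"
  by (simp add: cell_def ceiling_eq_iff field_simps)

lemma sum_cells:
  fixes g :: "nat \<Rightarrow> 'a :: real_vector"
  assumes "t \<in> {0<..1}"
  obtains k where "k \<le> n" "t \<in> cell n k"
    "(\<Sum>j\<le>n. indicator (cell n j) t *\<^sub>R g j) = g k"
proof -
  define k where "k = nat (\<lceil>(real n + 1) * t\<rceil> - 1)"
  have "0 < (real n + 1) * t" "(real n + 1) * t \<le> real n + 1"
    using assms by (auto intro: mult_left_le)
  hence "0 < \<lceil>(real n + 1) * t\<rceil>" "\<lceil>(real n + 1) * t\<rceil> \<le> int n + 1"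
    by (simp_all add: ceiling_le_iff)
  hence k: "k \<le> n" "t \<in> cell n j \<longleftrightarrow> j = k" for j
    by (auto simp: in_cell_iff k_def)
  have "(\<Sum>j\<le>n. indicator (cell n j) t *\<^sub>R g j) = (\<Sum>j\<le>n. if j = k then g k else 0)"
    by (intro sum.cong) (auto simp: k indicator_def)
  with k that[of k] show thesis by simp
qed

definition mass :: "nat \<Rightarrow> nat \<Rightarrow> real" where
  "mass n k = measure M (cell n k)"

definition approximant :: "nat \<Rightarrow> complex poly" where
  "approximant n = binom_sum (mass (Suc n)) (Suc n)"

lemma mass_nonneg: "mass n k \<ge> 0"
  by (simp add: mass_def)

lemma mass_le_Suc:
  assumes "k < n"
  shows "mass n k \<le> mass n (Suc k)"
proof -
  have c: "cell n j = {real j / (n + 1)<..real j / (n + 1) + 1 / (n + 1)}" for j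
    by (simp add: cell_def add_divide_distrib)
  have "real (Suc k) / (n + 1) + 1 / (n + 1) \<le> 1"
    using assms by (simp add: field_simps)
  thus ?thesis unfolding mass_def c
    by (intro increasing) (auto intro: divide_right_mono)
qed

lemma sum_mass: "(\<Sum>k\<le>n. mass n k) = measure M (space M)"
proof -
  have "(\<Sum>k\<le>n. mass n k) = (\<Sum>k\<le>n. LINT t|M. indicator (cell n k) t *\<^sub>R 1)"
    by (simp add: mass_def)
  also have "\<dots> = (LINT t|M. (\<Sum>k\<le>n. indicator (cell n k) t *\<^sub>R 1))"
    by (intro Bochner_Integration.integral_sum[symmetric] integrable_cell)
  also have "\<dots> = (LINT t|M. 1)"
    using support
  proof (intro integral_cong_AE; (measurable)?; eventually_elim)
    case (elim t)
    thus ?case using sum_cells[of t n "\<lambda>_. 1::real"] by metis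
  qed
  finally show ?thesis by simp
qed

lemma mass_last_pos: "mass n n > 0"
proof (rule ccontr)
  assume "\<not> mass n n > 0"
  moreover have "mass n k \<le> mass n n" if "k \<le> n" for k
    using that by (induction rule: inc_induct) (auto intro: order_trans mass_le_Suc)
  ultimately have "(\<Sum>k\<le>n. mass n k) \<le> 0" by (intro sum_nonpos) force
  thus False using nontrivial by (simp add: sum_mass)
qed

lemma integrable_exp: "integrable M (\<lambda>t. exp (s * complex_of_real t))"
proof (rule integrable_const_bound)
  show "AE t in M. norm (exp (s * complex_of_real t)) \<le> exp (norm s)"
    using support
  proof eventually_elim
    case (elim t)
    have "norm (exp (s * complex_of_real t)) \<le> exp (norm (s * of_real t))" by (rule norm_exp)
    also have "norm (s * of_real t) \<le> norm s"
      using elim by (auto simp: norm_mult intro!: mult_right_le_one_le)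
    finally show ?case by simp
  qed
qed measurable

lemma uniform_limit_transform:
  "uniform_limit (cball 0 R) (\<lambda>n. poly (approximant n)) transform sequentially"
proof -
  define C where "C = exp R * (R ^ 2 + R) * measure M (space M)"
  have bound: "norm (poly (binom_sum (mass n) n) s - transform s) \<le> C / n"
    if n: "n > 0" and s: "norm s \<le> R" for n s
  proof -
    define g where "g k = (1 + s / (2 * of_nat n)) ^ (n + k) * (1 - s / (2 * of_nat n)) ^ (n - k)" for k
    have int: "integrable M (\<lambda>t. indicator (cell n k) t *\<^sub>R g k)" for k
      by (rule integrable_cell)
    have "poly (binom_sum (mass n) n) s = (\<Sum>k\<le>n. mass n k *\<^sub>R g k)"
      by (simp add: poly_binom_sum g_def scaleR_conv_of_real)
    also have "\<dots> = (\<Sum>k\<le>n. LINT t|M. indicator (cell n k) t *\<^sub>R g k)"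
      by (simp add: mass_def less_top[symmetric])
    also have "\<dots> = (LINT t|M. (\<Sum>k\<le>n. indicator (cell n k) t *\<^sub>R g k))"
      using int by (intro Bochner_Integration.integral_sum[symmetric])
    finally have "poly (binom_sum (mass n) n) s - transform s =
        (LINT t|M. (\<Sum>k\<le>n. indicator (cell n k) t *\<^sub>R g k) - exp (s * of_real t))"
      unfolding transform_def
      by (simp only: Bochner_Integration.integral_diff Bochner_Integration.integrable_sum int integrable_exp)
    also have "norm \<dots> \<le> (LINT t|M. norm ((\<Sum>k\<le>n. indicator (cell n k) t *\<^sub>R g k) - exp (s * of_real t)))"
      by (rule integral_norm_bound)
    also have "\<dots> \<le> (LINT t|M. exp R * (R ^ 2 + R) / n)"
    proof (rule integral_mono_AE)
      show "AE t in M. norm ((\<Sum>k\<le>n. indicator (cell n k) t *\<^sub>R g k) - exp (s * of_real t))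
              \<le> exp R * (R ^ 2 + R) / n"
        using support
      proof eventually_elim
        case (elim t)
        then obtain k where k: "k \<le> n" "t \<in> cell n k"
            and eq: "(\<Sum>j\<le>n. indicator (cell n j) t *\<^sub>R g j) = g k"
          using sum_cells by blast
        have t: "real k < (n + 1) * t" "(n + 1) * t \<le> real k + 1"
          using k(2) by (auto simp: cell_def field_simps)
        have "\<bar>n * t - k\<bar> \<le> 1"
          using t elim k(1) by (auto simp: algebra_simps abs_le_iff)
        hence "\<bar>t - k / n\<bar> \<le> 1 / n"
          using n by (auto simp: field_simps abs_le_iff)
        thus ?case unfolding eq unfolding g_def
          using elim by (intro norm_binomial_minus_exp_le s n k(1)) auto
      qed
      show "integrable M (\<lambda>t. norm ((\<Sum>k\<le>n. indicator (cell n k) t *\<^sub>R g k) - exp (s * of_real t)))"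
        by (intro integrable_norm Bochner_Integration.integrable_diff
              Bochner_Integration.integrable_sum int integrable_exp)
    qed auto
    also have "\<dots> = C / n" by (simp add: C_def)
    finally show ?thesis .
  qed
  have "(\<lambda>n. C / real (Suc n)) \<longlonglongrightarrow> 0"
    by (rule LIMSEQ_Suc[OF lim_const_over_n])
  moreover have "\<forall>\<^sub>F n in sequentially. \<forall>s\<in>cball 0 R.
      dist (poly (approximant n) s) (transform s) \<le> C / real (Suc n)"
    using bound[of "Suc _"] by (auto simp: dist_norm approximant_def)
  ultimately show ?thesis
    unfolding uniform_limit_iff
    by (smt (verit) eventually_elim2 order_tendstoD(2))
qed

lemma norm_approximant_less:
  assumes "Re s > 0"
  shows "norm (poly (approximant n) (- s)) <
         norm (poly (approximant n) s)"
  unfolding approximant_def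
  using assms by (intro norm_binom_sum_less mass_nonneg mass_le_Suc mass_last_pos) auto

lemma approximant_even_odd:
  "\<exists>E D. \<forall>n s. poly (approximant n) s = poly (E n) (s ^ 2) + s * poly (D n) (s ^ 2)"
proof -
  have "\<forall>n. \<exists>e d. \<forall>s. poly (approximant n) s = poly e (s ^ 2) + s * poly d (s ^ 2)"
    using poly_even_odd_decomposition by metis
  thus ?thesis by metis
qed

text \<open>
  The even parts of the approximants converge to the even part of the transform. If the even part of
  a polynomial \<open>A\<close> vanishes at \<open>s\<close>, then \<open>A (- s) = - A s\<close>, which for \<open>Re s > 0\<close> contradicts
  the strict inequality between \<open>\<bar>A (- s)\<bar>\<close> and \<open>\<bar>A s\<bar>\<close>;
  hence its roots in the variable \<open>z = s ^ 2 / 4\<close> are nonpositive.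
\<close>
theorem even_part_in_Laguerre_Polya_plus:
  assumes holo: "f holomorphic_on UNIV"
    and f: "\<And>s. (transform s + transform (- s)) / 2 = f (s ^ 2 / 4)"
  shows "f \<in> Laguerre_Polya_plus"
proof -
  obtain E D where
    ED: "\<And>n s. poly (approximant n) s = poly (E n) (s ^ 2) + s * poly (D n) (s ^ 2)"
    using approximant_even_odd by blast
  define P where "P n = pcompose (E n) [:0, 4:]" for n
  have P: "poly (P n) z = poly (E n) (4 * z)" for n z
    by (simp add: P_def poly_pcompose mult.commute)
  have "z \<in> \<real>\<^sub>\<le>\<^sub>0" if "poly (P n) z = 0" for n z
  proof (rule ccontr)
    assume "z \<notin> \<real>\<^sub>\<le>\<^sub>0"
    then obtain s where s: "s ^ 2 = 4 * z" "Re s > 0" by (rule sqrt_of_4z_right_half_plane)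
    have "poly (approximant n) (- s) = - poly (approximant n) s" using that s(1) by (simp add: ED P)
    with norm_approximant_less[OF s(2), of n] show False by simp
  qed
  moreover have "uniform_limit K (\<lambda>n. poly (P n)) f sequentially" if K: "compact K" for K
  proof -
    obtain R where R: "\<And>z. z \<in> K \<Longrightarrow> norm z \<le> R"
      using compact_imp_bounded[OF K] by (auto simp: bounded_iff)
    have dom: "2 * csqrt z \<in> cball 0 (2 * sqrt R)" "- 2 * csqrt z \<in> cball 0 (2 * sqrt R)" if "z \<in> K" for z
      using R[OF that] by (simp_all add: norm_mult)
    have "uniform_limit K (\<lambda>n z. (poly (approximant n) (2 * csqrt z) + poly (approximant n) (- 2 * csqrt z)) / 2)
        (\<lambda>z. (transform (2 * csqrt z) + transform (- 2 * csqrt z)) / 2) sequentially"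
      using dom
      by (intro bounded_linear.uniform_limit[OF bounded_linear_divide] uniform_limit_add
            uniform_limit_compose'[OF uniform_limit_transform[of "2 * sqrt R"]]) auto
    moreover have "(poly (approximant n) (2 * csqrt z) + poly (approximant n) (- 2 * csqrt z)) / 2 = poly (P n) z" for n z
      by (simp add: ED P power_mult_distrib)
    moreover have "(transform (2 * csqrt z) + transform (- 2 * csqrt z)) / 2 = f z" for z
      using f[of "2 * csqrt z"] by (simp add: power_mult_distrib)
    ultimately show ?thesis by simp
  qed
  ultimately show ?thesis using holo unfolding Laguerre_Polya_plus_def by blast
qed

text \<open>
  The root condition follows as for the even part, now from \<open>A (- s) = A s\<close>. Convergence is first shown
  on a circle around the origin, where the factor \<open>s\<close> has constant modulus.
\<close>
theorem odd_part_in_Laguerre_Polya_plus: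
  assumes holo: "f holomorphic_on UNIV"
    and f: "\<And>s. (transform s - transform (- s)) / 2 = s * f (s ^ 2 / 4)"
  shows "f \<in> Laguerre_Polya_plus"
proof -
  obtain E D where
    ED: "\<And>n s. poly (approximant n) s = poly (E n) (s ^ 2) + s * poly (D n) (s ^ 2)"
    using approximant_even_odd by blast
  define P where "P n = pcompose (D n) [:0, 4:]" for n
  have P: "poly (P n) z = poly (D n) (4 * z)" for n z
    by (simp add: P_def poly_pcompose mult.commute)
  have "z \<in> \<real>\<^sub>\<le>\<^sub>0" if "poly (P n) z = 0" for n z
  proof (rule ccontr)
    assume "z \<notin> \<real>\<^sub>\<le>\<^sub>0"
    then obtain s where s: "s ^ 2 = 4 * z" "Re s > 0" by (rule sqrt_of_4z_right_half_plane)
    have "poly (approximant n) (- s) = poly (approximant n) s" using that s(1) by (simp add: ED P)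
    with norm_approximant_less[OF s(2), of n] show False by simp
  qed
  moreover have "uniform_limit K (\<lambda>n. poly (P n)) f sequentially" if K: "compact K" for K
  proof -
    obtain R where R: "R > 0" "\<And>z. z \<in> K \<Longrightarrow> norm z \<le> R"
      using compact_imp_bounded[OF K] unfolding bounded_pos by auto
    have "uniform_limit (cball 0 R) (\<lambda>n. poly (P n)) f sequentially"
    proof (rule uniform_limit_cball_of_sphere)
      show "f holomorphic_on cball 0 R" by (rule holomorphic_on_subset[OF holo]) simp
      define r where "r = 2 * sqrt R"
      have r: "r > 0" using R by (simp add: r_def)
      have dom: "2 * csqrt z \<in> cball 0 r" "- 2 * csqrt z \<in> cball 0 r" if "z \<in> sphere 0 R" for z
        using that by (simp_all add: norm_mult r_def)
      have "uniform_limit (sphere 0 R) (\<lambda>n z. (poly (approximant n) (2 * csqrt z) - poly (approximant n) (- 2 * csqrt z)) / 2)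
          (\<lambda>z. (transform (2 * csqrt z) - transform (- 2 * csqrt z)) / 2) sequentially"
        using dom
        by (intro bounded_linear.uniform_limit[OF bounded_linear_divide] uniform_limit_minus
              uniform_limit_compose'[OF uniform_limit_transform[of r]]) auto
      moreover have "(poly (approximant n) (2 * csqrt z) - poly (approximant n) (- 2 * csqrt z)) / 2 = 2 * csqrt z * poly (P n) z" for n z
        by (simp add: ED P power_mult_distrib)
      moreover have "(transform (2 * csqrt z) - transform (- 2 * csqrt z)) / 2 = 2 * csqrt z * f z" for z
        using f[of "2 * csqrt z"] by (simp add: power_mult_distrib)
      ultimately have L: "uniform_limit (sphere 0 R) (\<lambda>n z. 2 * csqrt z * poly (P n) z)
          (\<lambda>z. 2 * csqrt z * f z) sequentially" by (simp only:)
      have d: "dist (2 * csqrt z * x) (2 * csqrt z * y) = r * dist x y" if "z \<in> sphere 0 R" for x y z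
        using that by (simp add: dist_norm norm_mult r_def flip: right_diff_distrib)
      show "uniform_limit (sphere 0 R) (\<lambda>n. poly (P n)) f sequentially"
        unfolding uniform_limit_iff
      proof (intro allI impI)
        fix \<epsilon> :: real assume "\<epsilon> > 0"
        with r have "\<forall>\<^sub>F n in sequentially. \<forall>z\<in>sphere 0 R.
            dist (2 * csqrt z * poly (P n) z) (2 * csqrt z * f z) < r * \<epsilon>"
          using L unfolding uniform_limit_iff by simp
        thus "\<forall>\<^sub>F n in sequentially. \<forall>z\<in>sphere 0 R. dist (poly (P n) z) (f z) < \<epsilon>"
          by eventually_elim (use r d in auto)
      qed
    qed (use R in \<open>auto intro!: holomorphic_intros\<close>)
    thus ?thesis by (rule uniform_limit_on_subset) (use R in auto)
  qed
  ultimately show ?thesis using holo unfolding Laguerre_Polya_plus_def by blast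
qed

end

section \<open>An increasing density with hypergeometric moments\<close>

lemma nn_integral_Beta:
  fixes a b :: real
  assumes "a > 0" "b > 0"
  shows "(\<integral>\<^sup>+x. ennreal (x powr (a - 1) * (1 - x) powr (b - 1)) * indicator {0<..<1} x \<partial>lborel) =
           ennreal (Beta a b)"
  using has_integral_Beta_real[OF assms]
  by (intro nn_integral_has_integral_lebesgue') (auto simp: has_integral_Icc_iff_Ioo)

lemma nn_integral_Beta_square:
  fixes p b :: real
  assumes "p > -1" "b > 0"
  shows "(\<integral>\<^sup>+x. ennreal (x powr p * (1 - x ^ 2) powr (b - 1)) * indicator {0<..<1} x \<partial>lborel) =
           ennreal (Beta ((p + 1) / 2) b / 2)"
proof -
  define f where "f x = x powr ((p + 1) / 2 - 1) * (1 - x) powr (b - 1)" for x :: real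
  have ae: "AE x in lborel. x \<noteq> (0::real) \<and> x \<noteq> 1"
    using AE_lborel_singleton[of 0] AE_lborel_singleton[of "1::real"] by eventually_elim simp
  have "ennreal (Beta ((p + 1) / 2) b) = (\<integral>\<^sup>+x. ennreal (f x) * indicator {0<..<1} x \<partial>lborel)"
    unfolding f_def using assms by (subst nn_integral_Beta) auto
  also have "\<dots> = (\<integral>\<^sup>+x. ennreal (f x) * indicator {0^2..1^2} x \<partial>lborel)"
    by (rule nn_integral_cong_AE, use ae in eventually_elim) (auto simp: indicator_def)
  also have "\<dots> = (\<integral>\<^sup>+x. ennreal (f x * indicator {0^2..1^2} x) \<partial>lborel)"
    by (intro nn_integral_cong) (auto simp: indicator_def)
  also have "\<dots> = (\<integral>\<^sup>+x. f (x ^ 2) * (2 * x) * indicator {0..1} x \<partial>lborel)"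
  proof (rule nn_integral_substitution)
    show "set_borel_measurable borel {0\<^sup>2..1\<^sup>2} f"
      unfolding f_def set_borel_measurable_def by measurable
  qed (auto intro!: derivative_eq_intros continuous_intros)
  also have "\<dots> = (\<integral>\<^sup>+x. 2 * (ennreal (x powr p * (1 - x ^ 2) powr (b - 1)) * indicator {0<..<1} x) \<partial>lborel)"
  proof (rule nn_integral_cong_AE, use ae in eventually_elim)
    case (elim x)
    have "(x ^ 2) powr ((p + 1) / 2 - 1) * x = x powr p" if "x > 0"
    proof -
      have "(x ^ 2) powr ((p + 1) / 2 - 1) = x powr (2 * ((p + 1) / 2 - 1))"
        using that by (simp add: powr_powr flip: powr_numeral)
      also have "2 * ((p + 1) / 2 - 1) = p - 1" by (simp add: field_simps)
      also have "x powr (p - 1) * x = x powr p"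
        using that by (simp add: powr_diff)
      finally show ?thesis .
    qed
    hence eq: "f (x ^ 2) * (2 * x) = 2 * (x powr p * (1 - x ^ 2) powr (b - 1))" if "x > 0"
      using that by (simp add: f_def algebra_simps)
    show ?case
    proof (cases "x \<in> {0<..<1}")
      case True
      hence "ennreal (f (x ^ 2) * (2 * x)) = 2 * ennreal (x powr p * (1 - x ^ 2) powr (b - 1))"
        by (subst eq) (auto simp: ennreal_mult'[of 2])
      thus ?thesis using True by simp
    qed (use elim in auto)
  qed
  also have "\<dots> = 2 * (\<integral>\<^sup>+x. (ennreal (x powr p * (1 - x ^ 2) powr (b - 1)) * indicator {0<..<1} x) \<partial>lborel)"
    by (rule nn_integral_cmult) measurable
  finally have "2 * (\<integral>\<^sup>+x. (ennreal (x powr p * (1 - x ^ 2) powr (b - 1)) * indicator {0<..<1} x) \<partial>lborel)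
      = 2 * ennreal (Beta ((p + 1) / 2) b / 2)"
    by (simp flip: ennreal_numeral add: ennreal_mult'[symmetric])
  thus ?thesis by (simp add: ennreal_mult_cancel_left)
qed

lemma Beta_pos: "x > 0 \<Longrightarrow> y > 0 \<Longrightarrow> Beta x y > (0 :: real)"
  by (simp add: Beta_def Gamma_real_pos)

lemma Beta_add_nat:
  fixes x y :: real
  assumes "x > 0" "y > 0"
  shows "Beta (x + real n) y = Beta x y * pochhammer x n / pochhammer (x + y) n"
proof -
  have "x \<notin> \<int>\<^sub>\<le>\<^sub>0" "x + y \<notin> \<int>\<^sub>\<le>\<^sub>0"
    using assms by (auto elim!: nonpos_Ints_cases)
  moreover have "Gamma x > 0" "Gamma (x + y) > 0" using assms by (auto simp: Gamma_real_pos)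
  ultimately show ?thesis
    by (simp add: Beta_def pochhammer_Gamma add_ac)
qed

text \<open>
  The parameters of the target are \<open>(c, d)\<close> for the even part and \<open>(c + 1/2, d + 1/2)\<close> for the odd part,
  so that one measure serves both values of \<open>\<delta>\<close>. Up to normalisation it is the law of
  \<open>sqrt (X * Y)\<close> for independent \<open>X\<close> and \<open>Y\<close> distributed as \<open>Beta (1/2, c - 1/2)\<close> and
  \<open>Beta (1, d - 1)\<close>: its moments factor into Beta integrals. Its density at \<open>t\<close> is
  \<open>profile (t ^ 2)\<close>, where the integration variable \<open>y\<close> of \<open>profile\<close> stands for the value of \<open>Y\<close>.
\<close>
locale beta_product =
  fixes c d :: real
  assumes c: "1 / 2 < c" "c < 1" and d: "d > 1" and cd: "c + d < 5 / 2"
begin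

definition weight :: "real \<Rightarrow> real \<Rightarrow> real" where
  "weight u y = (1 - y) powr (d - 2) * y powr (1 - c) * (y - u) powr (c - 3 / 2)"

lemma weight_measurable [measurable]: "case_prod weight \<in> borel_measurable (borel \<Otimes>\<^sub>M borel)"
  unfolding weight_def[abs_def] by measurable

text \<open>
  The value is an extended real because the density may tend to infinity at \<open>1\<close>; finiteness of the
  total mass comes out of the computation of the moments.
\<close>
definition profile :: "real \<Rightarrow> ennreal" where
  "profile u = (\<integral>\<^sup>+y. ennreal (weight u y) * of_bool (u < y \<and> y < 1) \<partial>lborel)"

lemma profile_measurable [measurable]: "profile \<in> borel_measurable borel"
  unfolding profile_def[abs_def] by measurable

text \<open>
  The substitution \<open>y = u + (1 - u) * s\<close> moves the dependence on \<open>u\<close> from the range of integration into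
  two factors. Both increase with \<open>u\<close>, because \<open>c + d < 5/2\<close> makes the first exponent negative and
  \<open>c < 1\<close> makes the second one positive.
\<close>
lemma profile_rescaled:
  assumes "0 \<le> u" "u < 1"
  shows "profile u = (\<integral>\<^sup>+s. ennreal ((1 - u) powr (c + d - 5 / 2) * (s + u * (1 - s)) powr (1 - c) *
            ((1 - s) powr (d - 2) * s powr (c - 3 / 2))) * of_bool (0 < s \<and> s < 1) \<partial>lborel)"
proof -
  have "profile u = ennreal \<bar>1 - u\<bar> * (\<integral>\<^sup>+s. ennreal (weight u (u + (1 - u) * s)) *
           of_bool (u < u + (1 - u) * s \<and> u + (1 - u) * s < 1) \<partial>lborel)"
    unfolding profile_def
    by (rule nn_integral_real_affine) (use assms in \<open>auto simp: weight_def\<close>)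
  also have "\<dots> = (\<integral>\<^sup>+s. ennreal (1 - u) * (ennreal (weight u (u + (1 - u) * s)) *
           of_bool (u < u + (1 - u) * s \<and> u + (1 - u) * s < 1)) \<partial>lborel)"
    using assms by (subst nn_integral_cmult) (auto simp: weight_def)
  also have "\<dots> = (\<integral>\<^sup>+s. ennreal ((1 - u) powr (c + d - 5 / 2) * (s + u * (1 - s)) powr (1 - c) *
            ((1 - s) powr (d - 2) * s powr (c - 3 / 2))) * of_bool (0 < s \<and> s < 1) \<partial>lborel)"
  proof (rule nn_integral_cong)
    fix s :: real
    have iff: "u < u + (1 - u) * s \<and> u + (1 - u) * s < 1 \<longleftrightarrow> 0 < s \<and> s < 1"
    proof -
      have "u + (1 - u) * s < 1 \<longleftrightarrow> 0 < (1 - u) * (1 - s)" by (simp add: algebra_simps)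
      thus ?thesis using assms by (auto simp: zero_less_mult_iff)
    qed
    have "(1 - u) * weight u (u + (1 - u) * s) = (1 - u) powr (c + d - 5 / 2) * (s + u * (1 - s)) powr (1 - c) *
            ((1 - s) powr (d - 2) * s powr (c - 3 / 2))" if s: "0 < s" "s < 1"
    proof -
      have e: "1 - (u + (1 - u) * s) = (1 - u) * (1 - s)" "u + (1 - u) * s - u = (1 - u) * s"
        "u + (1 - u) * s = s + u * (1 - s)"
        by (simp_all add: algebra_simps)
      have "(1 - u) powr (c + d - 5 / 2) = (1 - u) powr (1 + (d - 2) + (c - 3 / 2))"
        by (simp add: algebra_simps)
      also have "\<dots> = (1 - u) * (1 - u) powr (d - 2) * (1 - u) powr (c - 3 / 2)"
        using assms by (simp only: powr_add) simp
      finally show ?thesis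
        using assms s unfolding weight_def e(1,2) by (simp add: e(3) powr_mult)
    qed
    thus "ennreal (1 - u) * (ennreal (weight u (u + (1 - u) * s)) *
           of_bool (u < u + (1 - u) * s \<and> u + (1 - u) * s < 1)) =
         ennreal ((1 - u) powr (c + d - 5 / 2) * (s + u * (1 - s)) powr (1 - c) *
            ((1 - s) powr (d - 2) * s powr (c - 3 / 2))) * of_bool (0 < s \<and> s < 1)"
      using assms unfolding iff by (auto simp flip: ennreal_mult')
  qed
  finally show ?thesis .
qed

lemma profile_mono:
  assumes "0 \<le> u" "u \<le> v" "v < 1"
  shows "profile u \<le> profile v"
proof -
  have "(1 - u) powr (c + d - 5 / 2) * (s + u * (1 - s)) powr (1 - c) * X \<le>
        (1 - v) powr (c + d - 5 / 2) * (s + v * (1 - s)) powr (1 - c) * X"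
    if "0 < s" "s < 1" "X \<ge> 0" for s X
    using that assms c cd
    by (intro mult_right_mono mult_mono powr_mono_both' powr_mono2 powr_mono2' add_left_mono) auto
  thus ?thesis
    using assms by (auto simp: profile_rescaled intro!: nn_integral_mono ennreal_leI)
qed

definition M :: "real measure" where
  "M = density lborel (\<lambda>t. profile (t ^ 2) * indicator {0<..<1} t)"

lemma sets_M [simp, measurable_cong]: "sets M = sets borel" and space_M [simp]: "space M = UNIV"
  by (simp_all add: M_def)

definition moment :: "nat \<Rightarrow> real" where
  "moment p = Beta ((real p + 1) / 2) (c - 1 / 2) * Beta (p / 2 + 1) (d - 1) / 2"

lemma moment_pos: "moment p > 0"
  using c d by (simp add: moment_def Beta_pos)

text \<open>
  The inner integral of the moments, for fixed \<open>y\<close>: scaling by \<open>t = sqrt y * x\<close> separates the powers of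
  \<open>y\<close> from a Beta integral.
\<close>
lemma nn_integral_weight:
  assumes y: "0 < y" "y < 1"
  shows "(\<integral>\<^sup>+t. ennreal (t ^ p * weight (t ^ 2) y) * of_bool (0 < t \<and> t ^ 2 < y) \<partial>lborel) =
     ennreal (y powr (p / 2) * (1 - y) powr (d - 2) * (Beta ((real p + 1) / 2) (c - 1 / 2) / 2))"
proof -
  define r where "r = sqrt y"
  have r: "r > 0" "y = r ^ 2" using y by (auto simp: r_def)
  have "(\<integral>\<^sup>+t. ennreal (t ^ p * weight (t ^ 2) y) * of_bool (0 < t \<and> t ^ 2 < y) \<partial>lborel) =
     ennreal \<bar>r\<bar> * (\<integral>\<^sup>+x. ennreal ((0 + r * x) ^ p * weight ((0 + r * x) ^ 2) y) *
         of_bool (0 < 0 + r * x \<and> (0 + r * x) ^ 2 < y) \<partial>lborel)"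
    by (rule nn_integral_real_affine) (use r in \<open>auto simp: weight_def\<close>)
  also have "\<dots> = (\<integral>\<^sup>+x. ennreal r * (ennreal ((r * x) ^ p * weight ((r * x) ^ 2) y) *
         of_bool (0 < r * x \<and> (r * x) ^ 2 < y)) \<partial>lborel)"
    using r by (subst nn_integral_cmult) (auto simp: weight_def)
  also have "\<dots> = (\<integral>\<^sup>+x. ennreal (y powr (p / 2) * (1 - y) powr (d - 2)) *
     (ennreal (x powr p * (1 - x ^ 2) powr ((c - 1 / 2) - 1)) * indicator {0<..<1} x) \<partial>lborel)"
  proof (rule nn_integral_cong)
    fix x :: real
    have iff: "0 < r * x \<and> (r * x) ^ 2 < y \<longleftrightarrow> 0 < x \<and> x < 1"
    proof -
      have "(r * x) ^ 2 < y \<longleftrightarrow> x ^ 2 < 1"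
        using r by (simp add: power_mult_distrib)
      moreover have "x ^ 2 < 1 \<longleftrightarrow> x < 1" if "x > 0"
        using that abs_square_less_1[of x] by simp
      ultimately show ?thesis using r by (auto simp: zero_less_mult_iff)
    qed
    have "r * ((r * x) ^ p * weight ((r * x) ^ 2) y) =
       y powr (p / 2) * (1 - y) powr (d - 2) * (x powr p * (1 - x ^ 2) powr (c - 3 / 2))"
      if x: "0 < x" "x < 1"
    proof -
      have "x ^ 2 < 1" using x by (simp add: power_less_one_iff)
      have "y - (r * x) ^ 2 = y * (1 - x ^ 2)" using r by (simp add: power_mult_distrib algebra_simps)
      hence k: "weight ((r * x) ^ 2) y = (1 - y) powr (d - 2) * y powr (1 - c) *
          (y powr (c - 3 / 2) * (1 - x ^ 2) powr (c - 3 / 2))"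
        using y \<open>x ^ 2 < 1\<close> by (simp add: weight_def powr_mult)
      have "r * r ^ p * (y powr (1 - c) * y powr (c - 3 / 2)) = r * r ^ p * y powr (- (1 / 2))"
        by (simp flip: powr_add)
      also have "\<dots> = r ^ p"
        using r by (simp add: powr_minus powr_half_sqrt)
      also have "r ^ p = y powr (p / 2)"
        using r(1) unfolding r(2) by (simp add: powr_powr powr_realpow flip: powr_numeral)
      finally have "r * r ^ p * (y powr (1 - c) * y powr (c - 3 / 2)) = y powr (p / 2)" .
      moreover have "r * ((r * x) ^ p * weight ((r * x) ^ 2) y) =
          (r * r ^ p * (y powr (1 - c) * y powr (c - 3 / 2))) * (1 - y) powr (d - 2) *
             (x ^ p * (1 - x ^ 2) powr (c - 3 / 2))"
        unfolding k by (simp add: power_mult_distrib mult_ac)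
      ultimately show ?thesis using x by (simp add: powr_realpow)
    qed
    thus "ennreal r * (ennreal ((r * x) ^ p * weight ((r * x) ^ 2) y) *
         of_bool (0 < r * x \<and> (r * x) ^ 2 < y)) =
         ennreal (y powr (p / 2) * (1 - y) powr (d - 2)) *
     (ennreal (x powr p * (1 - x ^ 2) powr ((c - 1 / 2) - 1)) * indicator {0<..<1} x)"
      using r unfolding iff by (auto simp: indicator_def simp flip: ennreal_mult')
  qed
  also have "\<dots> = ennreal (y powr (p / 2) * (1 - y) powr (d - 2)) * ennreal (Beta ((real p + 1) / 2) (c - 1 / 2) / 2)"
    using c by (subst nn_integral_cmult; (subst nn_integral_Beta_square)?; auto simp: add.commute)
  also have "\<dots> = ennreal (y powr (p / 2) * (1 - y) powr (d - 2) * (Beta ((real p + 1) / 2) (c - 1 / 2) / 2))"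
    by (rule ennreal_mult'[symmetric]) simp
  finally show ?thesis .
qed

lemma nn_integral_moment: "(\<integral>\<^sup>+t. ennreal (t ^ p) \<partial>M) = ennreal (moment p)"
proof -
  define B where "B = Beta ((real p + 1) / 2) (c - 1 / 2) / 2"
  have B: "B \<ge> 0" using c Beta_pos[of "(real p + 1) / 2" "c - 1 / 2"] by (simp add: B_def)
  have "(\<integral>\<^sup>+t. ennreal (t ^ p) \<partial>M) =
      (\<integral>\<^sup>+t. profile (t ^ 2) * indicator {0<..<1} t * ennreal (t ^ p) \<partial>lborel)"
    unfolding M_def by (subst nn_integral_density) auto
  also have "\<dots> = (\<integral>\<^sup>+t. (\<integral>\<^sup>+y. ennreal (t ^ p * weight (t ^ 2) y) * of_bool (0 < t \<and> t ^ 2 < y)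
        * of_bool (0 < y \<and> y < 1) \<partial>lborel) \<partial>lborel)"
  proof (rule nn_integral_cong)
    fix t :: real
    have "profile (t ^ 2) * indicator {0<..<1} t * ennreal (t ^ p) =
        (\<integral>\<^sup>+y. ennreal (weight (t ^ 2) y) * of_bool (t ^ 2 < y \<and> y < 1) * (indicator {0<..<1} t * ennreal (t ^ p)) \<partial>lborel)"
      unfolding profile_def by (subst nn_integral_multc) (auto simp: weight_def mult.assoc)
    also have "\<dots> = (\<integral>\<^sup>+y. ennreal (t ^ p * weight (t ^ 2) y) * of_bool (0 < t \<and> t ^ 2 < y)
        * of_bool (0 < y \<and> y < 1) \<partial>lborel)"
    proof (rule nn_integral_cong)
      fix y :: real
      have "t < 1" if "t ^ 2 < y" "y < 1" "t > 0"
        using that abs_square_less_1[of t] by simp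
      moreover have "0 < y" if "t ^ 2 < y" using that zero_le_power2[of t] by linarith
      ultimately show "ennreal (weight (t ^ 2) y) * of_bool (t ^ 2 < y \<and> y < 1) * (indicator {0<..<1} t * ennreal (t ^ p))
         = ennreal (t ^ p * weight (t ^ 2) y) * of_bool (0 < t \<and> t ^ 2 < y) * of_bool (0 < y \<and> y < 1)"
        by (auto simp: indicator_def ennreal_mult' mult_ac)
    qed
    finally show "profile (t ^ 2) * indicator {0<..<1} t * ennreal (t ^ p) = \<dots>" .
  qed
  also have "\<dots> = (\<integral>\<^sup>+y. (\<integral>\<^sup>+t. ennreal (t ^ p * weight (t ^ 2) y) * of_bool (0 < t \<and> t ^ 2 < y)
        * of_bool (0 < y \<and> y < 1) \<partial>lborel) \<partial>lborel)"
    by (rule lborel_pair.Fubini'[symmetric]) measurable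
  also have "\<dots> = (\<integral>\<^sup>+y. ennreal (y powr (p / 2) * (1 - y) powr (d - 2) * B)
        * of_bool (0 < y \<and> y < 1) \<partial>lborel)"
    by (intro nn_integral_cong) (auto simp: nn_integral_weight B_def add.commute)
  also have "\<dots> = (\<integral>\<^sup>+y. ennreal B *
      (ennreal (y powr ((p / 2 + 1) - 1) * (1 - y) powr ((d - 1) - 1)) * indicator {0<..<1} y) \<partial>lborel)"
    using B by (intro nn_integral_cong) (auto simp: indicator_def mult_ac simp flip: B_def ennreal_mult)
  also have "\<dots> = ennreal B * ennreal (Beta (p / 2 + 1) (d - 1))"
    using d by (subst nn_integral_cmult; (subst nn_integral_Beta)?; auto)
  also have "\<dots> = ennreal (moment p)"
    using B by (simp add: moment_def B_def add.commute ennreal_mult'[symmetric])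
  finally show ?thesis .
qed

lemma support: "AE t in M. t \<in> {0<..<1}"
  unfolding M_def by (subst AE_density) (auto simp: indicator_def)

lemma emeasure_space: "emeasure M UNIV = ennreal (moment 0)"
  using nn_integral_moment[of 0] by simp

sublocale finite_measure M
  by standard (simp add: emeasure_space)

text \<open>
  The density is cut off at \<open>1\<close>, so the comparison can fail at the one point that the shift moves to
  \<open>1\<close>; that point is a null set.
\<close>
lemma emeasure_shift_le:
  assumes "0 \<le> a" "a \<le> b" "b + l \<le> 1"
  shows "emeasure M {a<..a + l} \<le> emeasure M {b<..b + l}"
proof -
  define w where "w t = profile (t ^ 2) * indicator {0<..<1} t" for t
  have w [measurable]: "w \<in> borel_measurable borel" by (simp add: w_def[abs_def])
  have em: "emeasure M A = (\<integral>\<^sup>+t. w t * indicator A t \<partial>lborel)" if "A \<in> sets borel" for A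
    using that by (simp add: M_def w_def emeasure_density)
  have "emeasure M {a<..a + l} = (\<integral>\<^sup>+t. w t * indicator {a<..a + l} t \<partial>lborel)"
    by (simp add: em)
  also have "\<dots> \<le> (\<integral>\<^sup>+t. w ((b - a) + 1 * t) * indicator {b<..b + l} ((b - a) + 1 * t) \<partial>lborel)"
    using AE_lborel_singleton[of "1 - (b - a)"]
  proof (intro nn_integral_mono_AE, eventually_elim)
    case (elim t)
    show ?case
    proof (cases "t \<in> {a<..a + l}")
      case True
      hence "0 < t" "t \<le> b - a + t" "b - a + t < 1" using elim assms by auto
      moreover from this have "profile (t ^ 2) \<le> profile ((b - a + t) ^ 2)"
        by (intro profile_mono power_mono) (auto simp: power_less_one_iff)
      ultimately show ?thesis using True by (auto simp: w_def indicator_def)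
    qed simp
  qed
  also have "\<dots> = (\<integral>\<^sup>+t. w t * indicator {b<..b + l} t \<partial>lborel)"
    using nn_integral_real_affine[of "\<lambda>t. w t * indicator {b<..b + l} t" 1 "b - a"] by simp
  also have "\<dots> = emeasure M {b<..b + l}" by (simp add: em)
  finally show ?thesis .
qed

sublocale increasing_measure M
proof
  show "AE t in M. t \<in> {0<..1}" using support by eventually_elim auto
  show "measure M (space M) > 0"
    using moment_pos[of 0] by (simp add: measure_def emeasure_space)
  show "measure M {a<..a + l} \<le> measure M {b<..b + l}"
    if "0 \<le> a" "a \<le> b" "b + l \<le> 1" "0 \<le> l" for a b l
    using emeasure_shift_le[OF that(1-3)] by (simp add: emeasure_eq_measure)
qed simp

lemma integrable_power: "integrable M (\<lambda>t. t ^ p)"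
  and integral_power: "(LINT t|M. t ^ p) = moment p"
proof -
  have nonneg: "AE t in M. 0 \<le> t ^ p" using support by eventually_elim auto
  show "integrable M (\<lambda>t. t ^ p)"
    using nn_integral_moment[of p] nonneg by (intro integrableI_nonneg) auto
  show "(LINT t|M. t ^ p) = moment p"
    using nn_integral_moment[of p] nonneg moment_pos[of p]
    by (subst integral_eq_nn_integral) auto
qed

lemma transform_sums: "(\<lambda>p. of_real (moment p) * s ^ p / fact p) sums transform s"
proof -
  define f where "f p t = s ^ p / fact p * complex_of_real (t ^ p)" for p t
  have int: "integrable M (f p)" for p
    unfolding f_def by (intro integrable_mult_right integrable_of_real integrable_power)
  have nf: "norm (f p t) = norm s ^ p / fact p * \<bar>t\<bar> ^ p" for p t
    by (simp add: f_def norm_mult norm_divide norm_power power_abs)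
  have "(\<lambda>p. integral\<^sup>L M (f p)) sums (LINT t|M. (\<Sum>p. f p t))"
  proof (rule sums_integral)
    show "AE t in M. summable (\<lambda>p. norm (f p t))"
    proof (rule AE_I2)
      fix t
      show "summable (\<lambda>p. norm (f p t))"
        using summable_exp[of "norm s * \<bar>t\<bar>"]
        by (simp add: nf power_mult_distrib field_simps)
    qed
    show "summable (\<lambda>p. LINT t|M. norm (f p t))"
    proof (rule summable_comparison_test')
      show "summable (\<lambda>p. moment 0 * (inverse (fact p) * norm s ^ p))"
        by (intro summable_mult summable_exp)
      fix p
      have "(LINT t|M. norm (f p t)) \<le> (LINT t|M. norm s ^ p / fact p)"
      proof (rule integral_mono_AE)
        show "AE t in M. norm (f p t) \<le> norm s ^ p / fact p"
          using support
        proof eventually_elim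
          case (elim t)
          thus ?case unfolding nf by (intro mult_left_le power_le_one) auto
        qed
      qed (use int in auto)
      also have "\<dots> = moment 0 * (inverse (fact p) * norm s ^ p)"
        using moment_pos[of 0] by (simp add: measure_def emeasure_space field_simps)
      finally show "norm (LINT t|M. norm (f p t)) \<le> moment 0 * (inverse (fact p) * norm s ^ p)"
        by simp
    qed
  qed (rule int)
  also have "(\<lambda>p. integral\<^sup>L M (f p)) = (\<lambda>p. of_real (moment p) * s ^ p / fact p)"
    unfolding f_def by (simp del: of_real_power add: integral_power mult.commute)
  also have "(\<lambda>t. \<Sum>p. f p t) = (\<lambda>t. exp (s * of_real t))"
    by (simp add: f_def exp_def power_mult_distrib scaleR_conv_of_real divide_inverse mult_ac)
  finally show ?thesis by (simp add: transform_def)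
qed

lemma even_part_sums:
  "(\<lambda>j. of_real (moment (2 * j)) * s ^ (2 * j) / fact (2 * j)) sums ((transform s + transform (- s)) / 2)"
proof -
  define f where "f p = (of_real (moment p) * s ^ p / fact p + of_real (moment p) * (- s) ^ p / fact p) / 2" for p
  have "f sums ((transform s + transform (- s)) / 2)"
    unfolding f_def by (intro sums_divide sums_add transform_sums)
  hence "(\<lambda>j. f (2 * j)) sums ((transform s + transform (- s)) / 2)"
  proof (subst sums_mono_reindex)
    show "f p = 0" if "p \<notin> range (\<lambda>j. 2 * j)" for p
    proof -
      from that have "odd p" by (metis evenE rangeI)
      thus ?thesis by (simp add: f_def)
    qed
  qed (auto simp: strict_mono_def)
  thus ?thesis by (simp add: f_def mult_ac)
qed

lemma odd_part_sums:
  "(\<lambda>j. of_real (moment (2 * j + 1)) * s ^ (2 * j + 1) / fact (2 * j + 1)) sums ((transform s - transform (- s)) / 2)"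
proof -
  define f where "f p = (of_real (moment p) * s ^ p / fact p - of_real (moment p) * (- s) ^ p / fact p) / 2" for p
  have "f sums ((transform s - transform (- s)) / 2)"
    unfolding f_def by (intro sums_divide sums_diff transform_sums)
  hence "(\<lambda>j. f (2 * j + 1)) sums ((transform s - transform (- s)) / 2)"
  proof (subst sums_mono_reindex)
    show "f p = 0" if "p \<notin> range (\<lambda>j. 2 * j + 1)" for p
    proof -
      from that have "even p" by (metis oddE rangeI)
      thus ?thesis by (simp add: f_def)
    qed
  qed (auto simp: strict_mono_def)
  thus ?thesis by (simp add: f_def mult_ac)
qed

end

lemma Laguerre_Polya_plus_cmult:
  assumes f: "f \<in> Laguerre_Polya_plus" and k: "k \<noteq> 0"
  shows "(\<lambda>z. k * f z) \<in> Laguerre_Polya_plus"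
proof -
  from f have holo: "f holomorphic_on UNIV"
    and ex: "\<exists>P. (\<forall>n z. poly (P n) z = 0 \<longrightarrow> z \<in> \<real>\<^sub>\<le>\<^sub>0) \<and>
        (\<forall>K. compact K \<longrightarrow> uniform_limit K (\<lambda>n. poly (P n)) f sequentially)"
    by (simp_all add: Laguerre_Polya_plus_def)
  from ex obtain P where P: "\<And>n z. poly (P n) z = 0 \<Longrightarrow> z \<in> \<real>\<^sub>\<le>\<^sub>0"
      "\<And>K. compact K \<Longrightarrow> uniform_limit K (\<lambda>n. poly (P n)) f sequentially" by metis
  have poly_smult': "poly (smult k q) = (\<lambda>z. k * poly q z)" for q
    by (simp add: fun_eq_iff)
  have "uniform_limit K (\<lambda>n. poly (smult k (P n))) (\<lambda>z. k * f z) sequentially" if "compact K" for K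
    unfolding poly_smult' by (rule bounded_linear.uniform_limit[OF bounded_linear_mult_right P(2)[OF that]])
  moreover have "poly (smult k (P n)) z = 0 \<Longrightarrow> z \<in> \<real>\<^sub>\<le>\<^sub>0" for n z
    using P(1) k by simp
  moreover have "(\<lambda>z. k * f z) holomorphic_on UNIV"
    by (rule holomorphic_on_mult[OF holomorphic_on_const holo])
  ultimately show ?thesis
    unfolding Laguerre_Polya_plus_def mem_Collect_eq
    by (intro conjI exI[of _ "\<lambda>n. smult k (P n)"] allI impI)
qed

lemma Laguerre_Polya_plus_cmultD:
  assumes "(\<lambda>z. k * f z) \<in> Laguerre_Polya_plus" and k: "k \<noteq> 0"
  shows "f \<in> Laguerre_Polya_plus"
proof -
  have "(\<lambda>z. inverse k * (k * f z)) = f" using k by (simp add: fun_eq_iff)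
  moreover have "(\<lambda>z. inverse k * (k * f z)) \<in> Laguerre_Polya_plus"
    by (rule Laguerre_Polya_plus_cmult[OF assms(1)]) (use k in simp)
  ultimately show ?thesis by (simp only:)
qed

section \<open>Identification with the hypergeometric function\<close>

lemma hypergeo_1F2_one_sums:
  "(\<lambda>n. z ^ n / (pochhammer b n * pochhammer c n)) sums hypergeo_1F2 1 b c z"
  using summable_sums[OF summable_hypergeo_1F2[of 1 b c z]]
  by (simp add: hypergeo_1F2_def flip: pochhammer_fact)

lemma holomorphic_hypergeo_1F2: "hypergeo_1F2 a b c holomorphic_on UNIV"
proof -
  have "hypergeo_1F2 a b c holomorphic_on ball 0 r" for r
  proof (rule power_series_holomorphic)
    fix w
    show "(\<lambda>n. pochhammer a n / (pochhammer b n * pochhammer c n * fact n) * (w - 0) ^ n) sums hypergeo_1F2 a b c w"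
      using summable_sums[OF summable_hypergeo_1F2[of a b c w]]
      by (simp add: hypergeo_1F2_def)
  qed
  hence "hypergeo_1F2 a b c field_differentiable at z" for z
    by (rule holomorphic_on_imp_differentiable_at[of _ "ball 0 (norm z + 1)"]) auto
  thus ?thesis
    by (auto simp: holomorphic_on_def intro: field_differentiable_at_within)
qed

lemma hypergeo_1F2_commute: "hypergeo_1F2 a b c = hypergeo_1F2 a c b"
  by (simp add: hypergeo_1F2_def[abs_def] mult.commute)

context beta_product
begin

text \<open>
  By the functional equation of the Beta function, the moments produce the Pochhammer symbols of \<open>c\<close> and
  \<open>d\<close> in the denominator and those of \<open>1/2\<close> and \<open>1\<close> in the numerator; the duplication formula for
  \<open>fact (2 * j)\<close> cancels the latter and leaves the power of \<open>4\<close>.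
\<close>
lemma moment_even:
  "moment (2 * j) / fact (2 * j) = moment 0 / (4 ^ j * pochhammer c j * pochhammer d j)"
proof -
  have e: "(real (2 * j) + 1) / 2 = 1 / 2 + real j" "real (2 * j) / 2 + 1 = 1 + real j"
    by (simp_all add: field_simps)
  have "moment (2 * j) = moment 0 * (pochhammer (1 / 2) j * fact j) / (pochhammer c j * pochhammer d j)"
    unfolding moment_def e using c d by (simp add: Beta_add_nat mult_ac flip: pochhammer_fact)
  moreover have "fact (2 * j) = 4 ^ j * (pochhammer (1 / 2) j * fact j :: real)"
    by (simp add: fact_double power_mult)
  moreover have "pochhammer (1 / 2 :: real) j > 0" by (intro pochhammer_pos) auto
  ultimately show ?thesis by simp
qed

lemma moment_odd:
  "moment (2 * j + 1) / fact (2 * j + 1) =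
     moment 1 / (4 ^ j * pochhammer (c + 1 / 2) j * pochhammer (d + 1 / 2) j)"
proof -
  have e: "(real (2 * j + 1) + 1) / 2 = 1 + real j" "real (2 * j + 1) / 2 + 1 = 3 / 2 + real j"
    by (simp_all add: field_simps)
  have "moment (2 * j + 1) = moment 1 * (pochhammer (3 / 2) j * fact j) /
      (pochhammer (c + 1 / 2) j * pochhammer (d + 1 / 2) j)"
  proof -
    have "Beta (1 + real j) (c - 1 / 2) = Beta 1 (c - 1 / 2) * fact j / pochhammer (c + 1 / 2) j"
      using Beta_add_nat[of 1 "c - 1 / 2" j] c by (simp add: add.commute flip: pochhammer_fact)
    moreover have "Beta (3 / 2 + real j) (d - 1) =
        Beta (3 / 2) (d - 1) * pochhammer (3 / 2) j / pochhammer (d + 1 / 2) j"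
      using Beta_add_nat[of "3 / 2" "d - 1" j] d by (simp add: add.commute)
    ultimately show ?thesis unfolding moment_def e by (simp add: mult_ac)
  qed
  moreover have "fact (2 * j + 1) = 4 ^ j * (pochhammer (3 / 2) j * fact j :: real)"
  proof -
    have "(1 / 2 :: real) * pochhammer (3 / 2) j = pochhammer (1 / 2) j * (1 / 2 + real j)"
      using pochhammer_rec[of "1 / 2 :: real" j] pochhammer_Suc[of "1 / 2 :: real" j] by simp
    hence p: "pochhammer (3 / 2 :: real) j = (2 * real j + 1) * pochhammer (1 / 2) j"
      by (simp add: algebra_simps)
    have "fact (2 * j + 1) = (2 * real j + 1) * fact (2 * j)" by simp
    thus ?thesis by (simp add: p fact_double power_mult)
  qed
  moreover have "pochhammer (3 / 2 :: real) j > 0" by (intro pochhammer_pos) auto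
  ultimately show ?thesis by simp
qed

lemma even_part:
  "(transform s + transform (- s)) / 2 =
     of_real (moment 0) * hypergeo_1F2 1 (of_real c) (of_real d) (s ^ 2 / 4)"
proof (rule sums_unique2[OF even_part_sums])
  have "of_real (moment (2 * j)) * s ^ (2 * j) / fact (2 * j) = of_real (moment 0) *
      ((s ^ 2 / 4) ^ j / (pochhammer (of_real c) j * pochhammer (of_real d) j))" for j
  proof -
    have "of_real (moment (2 * j)) * s ^ (2 * j) / fact (2 * j) =
        of_real (moment (2 * j) / fact (2 * j)) * s ^ (2 * j)" by simp
    also have "\<dots> = of_real (moment 0) *
      ((s ^ 2 / 4) ^ j / (pochhammer (of_real c) j * pochhammer (of_real d) j))"
      unfolding moment_even by (simp add: power_mult power_divide pochhammer_of_real[symmetric])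
    finally show ?thesis .
  qed
  thus "(\<lambda>j. of_real (moment (2 * j)) * s ^ (2 * j) / fact (2 * j)) sums
      (of_real (moment 0) * hypergeo_1F2 1 (of_real c) (of_real d) (s ^ 2 / 4))"
    by (simp only:) (intro sums_mult hypergeo_1F2_one_sums)
qed

lemma odd_part:
  "(transform s - transform (- s)) / 2 =
     s * (of_real (moment 1) * hypergeo_1F2 1 (of_real (c + 1 / 2)) (of_real (d + 1 / 2)) (s ^ 2 / 4))"
proof (rule sums_unique2[OF odd_part_sums])
  have "of_real (moment (2 * j + 1)) * s ^ (2 * j + 1) / fact (2 * j + 1) = s * (of_real (moment 1) *
      ((s ^ 2 / 4) ^ j / (pochhammer (of_real (c + 1 / 2)) j * pochhammer (of_real (d + 1 / 2)) j)))" for j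
  proof -
    have "of_real (moment (2 * j + 1)) * s ^ (2 * j + 1) / fact (2 * j + 1) =
        of_real (moment (2 * j + 1) / fact (2 * j + 1)) * s ^ (2 * j + 1)"
      by (simp only: of_real_divide of_real_fact times_divide_eq_left)
    also have "\<dots> = s * (of_real (moment 1) *
      ((s ^ 2 / 4) ^ j / (pochhammer (of_real (c + 1 / 2)) j * pochhammer (of_real (d + 1 / 2)) j)))"
      unfolding moment_odd
      by (simp add: power_mult power_divide pochhammer_of_real[symmetric] mult.assoc mult.left_commute
            del: of_real_add)
    finally show ?thesis .
  qed
  thus "(\<lambda>j. of_real (moment (2 * j + 1)) * s ^ (2 * j + 1) / fact (2 * j + 1)) sums
      (s * (of_real (moment 1) * hypergeo_1F2 1 (of_real (c + 1 / 2)) (of_real (d + 1 / 2)) (s ^ 2 / 4)))"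
    by (simp only:) (intro sums_mult hypergeo_1F2_one_sums)
qed

lemma hypergeo_1F2_in_Laguerre_Polya_plus:
  "hypergeo_1F2 1 (of_real c) (of_real d) \<in> Laguerre_Polya_plus" (is "?f \<in> _")
proof -
  have "(\<lambda>z. of_real (moment 0) * ?f z) \<in> Laguerre_Polya_plus"
  proof (rule even_part_in_Laguerre_Polya_plus)
    show "(\<lambda>z. of_real (moment 0) * ?f z) holomorphic_on UNIV"
      by (rule holomorphic_on_mult[OF holomorphic_on_const holomorphic_hypergeo_1F2])
  qed (rule even_part)
  moreover have "complex_of_real (moment 0) \<noteq> 0" using moment_pos[of 0] by simp
  ultimately show ?thesis by (rule Laguerre_Polya_plus_cmultD)
qed

lemma hypergeo_1F2_half_shift_in_Laguerre_Polya_plus: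
  "hypergeo_1F2 1 (of_real (c + 1 / 2)) (of_real (d + 1 / 2)) \<in> Laguerre_Polya_plus" (is "?f \<in> _")
proof -
  have "(\<lambda>z. of_real (moment 1) * ?f z) \<in> Laguerre_Polya_plus"
  proof (rule odd_part_in_Laguerre_Polya_plus)
    show "(\<lambda>z. of_real (moment 1) * ?f z) holomorphic_on UNIV"
      by (rule holomorphic_on_mult[OF holomorphic_on_const holomorphic_hypergeo_1F2])
  qed (rule odd_part)
  moreover have "complex_of_real (moment 1) \<noteq> 0" using moment_pos[of 1] by simp
  ultimately show ?thesis by (rule Laguerre_Polya_plus_cmultD)
qed

end

lemma hypergeo_1F2_in_Laguerre_Polya_plus_of_triangle:
  fixes \<delta> b1 b2 :: real
  assumes "\<delta> \<in> {0, 1/2}" "1/2 + \<delta> < b1" "b1 < 1 + \<delta>" "b2 > 1 + \<delta>" "b1 + b2 < 5/2 + 2 * \<delta>"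
  shows "hypergeo_1F2 1 (of_real b1) (of_real b2) \<in> Laguerre_Polya_plus"
proof -
  interpret beta_product "b1 - \<delta>" "b2 - \<delta>"
    by standard (use assms(2-5) in linarith)+
  from assms(1) consider "\<delta> = 0" | "\<delta> = 1 / 2" by auto
  thus ?thesis
  proof cases
    case 1
    thus ?thesis using hypergeo_1F2_in_Laguerre_Polya_plus by (simp only: 1 diff_zero)
  next
    case 2
    thus ?thesis using hypergeo_1F2_half_shift_in_Laguerre_Polya_plus by (simp only: 2 diff_add_cancel)
  qed
qed

theorem proposition4p4:
  fixes \<delta> b1 b2 :: real
  assumes "\<delta> \<in> {0, 1/2}"
    and "(1/2 + \<delta> < b1 \<and> b1 < 1 + \<delta> \<and> b2 > 1 + \<delta> \<and> b1 + b2 < 5/2 + 2 * \<delta>) \<or>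
         (1/2 + \<delta> < b2 \<and> b2 < 1 + \<delta> \<and> b1 > 1 + \<delta> \<and> b1 + b2 < 5/2 + 2 * \<delta>)"
  shows "(\<lambda>z. hypergeo_1F2 1 (complex_of_real b1) (complex_of_real b2) z) \<in> Laguerre_Polya_plus"
  using assms(2)
proof
  assume "1/2 + \<delta> < b1 \<and> b1 < 1 + \<delta> \<and> b2 > 1 + \<delta> \<and> b1 + b2 < 5/2 + 2 * \<delta>"
  thus ?thesis
    by (intro hypergeo_1F2_in_Laguerre_Polya_plus_of_triangle[OF assms(1)]) (elim conjE, assumption)+
next
  assume "1/2 + \<delta> < b2 \<and> b2 < 1 + \<delta> \<and> b1 > 1 + \<delta> \<and> b1 + b2 < 5/2 + 2 * \<delta>"
  hence "hypergeo_1F2 1 (of_real b2) (of_real b1) \<in> Laguerre_Polya_plus"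
    by (intro hypergeo_1F2_in_Laguerre_Polya_plus_of_triangle[OF assms(1)])
       (elim conjE, (assumption | simp only: add.commute))+
  thus ?thesis by (subst hypergeo_1F2_commute)
qed

end
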